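(* Let $R$ be an $\mathsf{f}$-commutative finitely generated ring. If $R$ is nil, then $R$ is a nilpotent ring.
   Context: Rings are associative, not necessarily with unity; "finitely generated" means finitely generated as a (not necessarily unital) ring. A ring is nil if each of its elements is nilpotent, and nilpotent if for some integer $n>0$ one has $a_1\cdots a_n=0$ for all its elements $a_1,\dots,a_n$. A left action of a semigroup $\mathfrak{S}$ on a ring $R$ is a map $\mathfrak{S}\times R\to R$, $(\lambda,x)\mapsto\lambda\cdot x$, with $(\lambda\gamma)\cdot x=\lambda\cdot(\gamma\cdot x)$ and $\lambda\cdot(xy)=(\lambda\cdot x)y$ for all $\lambda,\gamma\in\mathfrak{S}$, $x,y\in R$. A ring $R$ is $\mathsf{f}$-commutative if there exist a semigroup $\mathfrak{S}$ acting on the left of $R$ in this sense and a map $\mathsf{f}:R\times R\to\mathfrak{S}$ such that $ab=\mathsf{f}(a,b)\cdot(ba)$ for all $a,b\in R$. *)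

theory Defs
  imports Complex_Main
begin

text \<open>Rings are types of class \<^class>\<open>ring\<close>, which has no unity, so neither \<^term>\<open>prod_list\<close>
  nor the power operation applies. The product below is meaningful for nonempty lists only.\<close>

fun nonempty_prod :: "'a::times list \<Rightarrow> 'a" where
  "nonempty_prod [a] = a"
| "nonempty_prod (a # b # bs) = a * nonempty_prod (b # bs)"

definition nil_ring :: "'a::ring itself \<Rightarrow> bool" where
  "nil_ring _ \<longleftrightarrow> (\<forall>a::'a. \<exists>n>0. nonempty_prod (replicate n a) = 0)"

definition nilpotent_ring :: "'a::ring itself \<Rightarrow> bool" where
  "nilpotent_ring _ \<longleftrightarrow> (\<exists>n>0. \<forall>as::'a list. length as = n \<longrightarrow> nonempty_prod as = 0)"

definition is_subring :: "'a::ring set \<Rightarrow> bool" where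
  "is_subring S \<longleftrightarrow> 0 \<in> S \<and> (\<forall>x\<in>S. \<forall>y\<in>S. x - y \<in> S \<and> x * y \<in> S)"

definition finitely_generated_ring :: "'a::ring itself \<Rightarrow> bool" where
  "finitely_generated_ring _ \<longleftrightarrow> (\<exists>X::'a set. finite X \<and> is_subring hull X = UNIV)"

text \<open>No additivity in the ring argument is required.\<close>

definition left_action :: "('s::semigroup_mult \<Rightarrow> 'a::ring \<Rightarrow> 'a) \<Rightarrow> bool" where
  "left_action act \<longleftrightarrow>
     (\<forall>l g x. act (l * g) x = act l (act g x)) \<and>
     (\<forall>l x y. act l (x * y) = act l x * y)"

text \<open>HOL cannot quantify existentially over types, so the semigroup is the type parameter \<open>'s\<close>;
  being free in a hypothesis, it ranges over all semigroups.\<close>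

definition f_commutative :: "'s::semigroup_mult itself \<Rightarrow> 'a::ring itself \<Rightarrow> bool" where
  "f_commutative _ _ \<longleftrightarrow>
     (\<exists>(act :: 's \<Rightarrow> 'a \<Rightarrow> 'a) (f :: 'a \<Rightarrow> 'a \<Rightarrow> 's).
        left_action act \<and> (\<forall>a b. a * b = act (f a b) (b * a)))"

end

theory Submission
  imports Defs "HOL-Library.Multiset"
begin

text \<open>In an f-commutative ring, \<open>abc = f(a,b) \<cdot> (bac)\<close> and \<open>\<lambda> \<cdot> 0 = (\<lambda> \<cdot> 0) 0 = 0\<close>, so
  whether a product vanishes does not depend on the order of its factors. A sufficiently long word in
  finitely many nilpotent generators can therefore be rearranged to begin with a vanishing power of
  one of them. The factors of an arbitrary product are reduced to generators one at a time: the
  elements that give \<open>0\<close> in the first position form a subring.\<close>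

lemma nonempty_prod_Cons:
  "bs \<noteq> [] \<Longrightarrow> nonempty_prod (a # bs) = a * nonempty_prod bs"
  by (cases bs) auto

lemma nonempty_prod_append:
  fixes as bs :: "'a::semigroup_mult list"
  assumes "as \<noteq> []" "bs \<noteq> []"
  shows "nonempty_prod (as @ bs) = nonempty_prod as * nonempty_prod bs"
  using assms
  by (induction as rule: list_nonempty_induct) (auto simp: nonempty_prod_Cons mult.assoc)

lemma left_action_zero:
  assumes "left_action act"
  shows "act l 0 = 0"
proof -
  have "act l (0 * 0) = act l 0 * 0"
    using assms unfolding left_action_def by blast
  then show ?thesis by simp
qed

text \<open>The second rule needs a factor \<open>c\<close> on the right. Without a unity, the case
  of no such factor is not an instance of it and gets its own rule.\<close>

lemma f_commutative_swap_zero: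
  fixes a b c :: "'a::ring"
  assumes "f_commutative TYPE('s::semigroup_mult) TYPE('a)"
  shows "b * a = 0 \<Longrightarrow> a * b = 0" and "b * a * c = 0 \<Longrightarrow> a * b * c = 0"
proof -
  obtain act :: "'s \<Rightarrow> 'a \<Rightarrow> 'a" and f
    where act: "left_action act" and f: "\<And>a b. a * b = act (f a b) (b * a)"
    using assms unfolding f_commutative_def by blast
  show "a * b = 0" if "b * a = 0"
    using f[of a b] that by (simp add: left_action_zero[OF act])
  show "a * b * c = 0" if "b * a * c = 0"
  proof -
    have "a * b * c = act (f a b) (b * a) * c"
      using f[of a b] by simp
    also have "\<dots> = act (f a b) (b * a * c)"
      using act unfolding left_action_def by metis
    finally show ?thesis
      using that by (simp add: left_action_zero[OF act])
  qed
qed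

text \<open>A nonempty block multiplies out to a single ring element, so whole blocks swap like
  single factors. They stand at the front because the action is only known to commute with
  multiplication on the right.\<close>

lemma f_commutative_prod_swap_zero:
  fixes xs ys zs :: "'a::ring list"
  assumes "f_commutative TYPE('s::semigroup_mult) TYPE('a)"
    and "nonempty_prod (xs @ ys @ zs) = 0"
  shows "nonempty_prod (ys @ xs @ zs) = 0"
proof (cases "xs = [] \<or> ys = []")
  case True
  then show ?thesis using assms(2) by auto
next
  case False
  note swap = f_commutative_swap_zero[OF assms(1)]
  show ?thesis
  proof (cases "zs = []")
    case True
    then show ?thesis
      using False assms(2) by (simp add: nonempty_prod_append swap(1))
  next
    case zs: False
    then have "nonempty_prod xs * nonempty_prod ys * nonempty_prod zs = 0"
      using False assms(2) by (simp add: nonempty_prod_append mult.assoc)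
    from swap(2)[OF this] show ?thesis
      using False zs by (simp add: nonempty_prod_append mult.assoc)
  qed
qed

text \<open>The tail \<open>cs\<close> is what makes the induction work: swaps happen only at the
  front, so the first letter is parked in the tail while the induction hypothesis rearranges the
  others.\<close>

lemma f_commutative_prod_permute_zero:
  fixes as bs cs :: "'a::ring list"
  assumes fc: "f_commutative TYPE('s::semigroup_mult) TYPE('a)"
    and "mset as = mset bs" and "nonempty_prod (as @ cs) = 0"
  shows "nonempty_prod (bs @ cs) = 0"
  using assms(2,3)
proof (induction as arbitrary: bs cs)
  case Nil
  then show ?case by simp
next
  case (Cons a as)
  note swap = f_commutative_prod_swap_zero[OF fc]
  have "a \<in> set bs"
    using Cons.prems(1) by (metis list.set_intros(1) set_mset_mset)
  then obtain bs1 bs2 where bs: "bs = bs1 @ a # bs2"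
    by (meson split_list)
  have "mset as = mset (bs1 @ bs2)"
    using Cons.prems(1) by (simp add: bs)
  moreover have "nonempty_prod (as @ a # cs) = 0"
    using swap[of "[a]" as cs] Cons.prems(2) by simp
  ultimately have "nonempty_prod ((bs1 @ bs2) @ a # cs) = 0"
    by (rule Cons.IH)
  \<comment> \<open>Two block swaps put \<open>a\<close> in its place: \<open>bs1 bs2 a cs\<close>
    becomes \<open>bs2 bs1 a cs\<close>, then \<open>bs1 a bs2 cs\<close>.\<close>
  then have "nonempty_prod (bs2 @ (bs1 @ [a]) @ cs) = 0"
    using swap[of bs1 bs2 "a # cs"] by simp
  then show ?case
    using swap[of bs2 "bs1 @ [a]" cs] by (simp add: bs)
qed

lemma ex_frequent_letter:
  fixes n :: "'a \<Rightarrow> nat"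
  assumes "finite X" "set w \<subseteq> X" "(\<Sum>x\<in>X. n x) < length w"
  shows "\<exists>x\<in>X. n x \<le> count (mset w) x"
proof (rule ccontr)
  assume "\<not> ?thesis"
  \<comment> \<open>Although each count is strictly smaller than \<open>n x\<close>, the sums are
    equal when \<open>X\<close> is empty.\<close>
  then have "(\<Sum>x\<in>X. count (mset w) x) \<le> (\<Sum>x\<in>X. n x)"
    by (intro sum_mono) force
  moreover have "length w = (\<Sum>x\<in>X. count (mset w) x)"
    using sum_count_set[OF assms(2,1)] by (simp add: count_mset)
  ultimately show False using assms(3) by simp
qed

lemma f_commutative_long_word_zero:
  fixes X :: "'a::ring set"
  assumes fc: "f_commutative TYPE('s::semigroup_mult) TYPE('a)"
    and "finite X" and n: "\<And>x. x \<in> X \<Longrightarrow> n x > 0 \<and> nonempty_prod (replicate (n x) x) = 0"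
    and "set w \<subseteq> X" "(\<Sum>x\<in>X. n x) < length w"
  shows "nonempty_prod w = 0"
proof -
  obtain x where x: "x \<in> X" "n x \<le> count (mset w) x"
    using ex_frequent_letter assms(2,4,5) by blast
  then have "mset (replicate (n x) x) \<subseteq># mset w"
    by (simp add: count_le_replicate_mset_subset_eq)
  then obtain v where "mset w = mset (replicate (n x) x) + mset v"
    by (metis ex_mset subset_mset.le_iff_add)
  then have "mset (replicate (n x) x @ v) = mset w"
    by simp
  \<comment> \<open>Since \<open>n x > 0\<close>, the power is a nonempty word, and its product 0
    splits off whenever \<open>v\<close> is nonempty too.\<close>
  moreover have "nonempty_prod (replicate (n x) x @ v) = 0"
    using n[OF x(1)] by (cases "v = []") (simp_all add: nonempty_prod_append)
  ultimately show ?thesis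
    using f_commutative_prod_permute_zero[OF fc, of "replicate (n x) x @ v" w "[]"]
    by simp
qed

lemma is_subring_left_annihilator_of_prod:
  fixes bs :: "'a::ring list"
  shows "is_subring {r. nonempty_prod (r # bs) = 0}"
  by (cases "bs = []")
    (auto simp: is_subring_def nonempty_prod_Cons left_diff_distrib mult.assoc)

text \<open>By induction on \<open>as\<close>, the arbitrary factors: each one, once replaced by a
  generator, moves into \<open>w\<close>, so the total length stays \<open>N\<close>.\<close>

lemma prod_zero_if_generator_words_zero:
  fixes X :: "'a::ring set"
  assumes fc: "f_commutative TYPE('s::semigroup_mult) TYPE('a)"
    and gen: "is_subring hull X = UNIV"
    and words: "\<And>w. set w \<subseteq> X \<Longrightarrow> length w = N \<Longrightarrow> nonempty_prod w = 0"
    and "set w \<subseteq> X" "length as + length w = N"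
  shows "nonempty_prod (as @ w) = 0"
  using assms(4,5)
proof (induction as arbitrary: w)
  case Nil
  then show ?case using words by simp
next
  case (Cons a as)
  have "a \<in> is_subring hull X"
    by (simp add: gen)
  then have "nonempty_prod (a # as @ w) = 0"
  \<comment> \<open>With \<open>as\<close> and \<open>w\<close> fixed, the first factors that give 0
    form a subring, so \<open>a\<close> may be taken in \<open>X\<close>.\<close>
  proof (rule hull_induct)
    fix x assume "x \<in> X"
    then have "nonempty_prod (as @ x # w) = 0"
      using Cons.IH[of "x # w"] Cons.prems by simp
    then show "nonempty_prod (x # as @ w) = 0"
      using f_commutative_prod_swap_zero[OF fc, of as "[x]" w] by simp
  qed (rule is_subring_left_annihilator_of_prod)
  then show ?case by simp
qed

theorem theorem4p6:
  assumes "f_commutative TYPE('s::semigroup_mult) TYPE('a::ring)"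
    and "finitely_generated_ring TYPE('a)"
    and "nil_ring TYPE('a)"
  shows "nilpotent_ring TYPE('a)"
proof -
  obtain X :: "'a set" where X: "finite X" "is_subring hull X = UNIV"
    using assms(2) unfolding finitely_generated_ring_def by blast
  obtain n :: "'a \<Rightarrow> nat" where n: "\<And>x. n x > 0 \<and> nonempty_prod (replicate (n x) x) = 0"
    using assms(3) unfolding nil_ring_def by metis
  \<comment> \<open>The successor yields the strict bound of the pigeonhole argument and keeps
    \<open>?N\<close> positive even if \<open>X\<close> is empty.\<close>
  let ?N = "Suc (\<Sum>x\<in>X. n x)"
  have words: "nonempty_prod w = 0" if "set w \<subseteq> X" "length w = ?N" for w
    using f_commutative_long_word_zero[OF assms(1) X(1) n that(1)] that(2) by simp
  have "nonempty_prod as = 0" if "length as = ?N" for as :: "'a list"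
    using prod_zero_if_generator_words_zero[OF assms(1) X(2) words, where as = as and w = "[]"] that
    by simp
  then show ?thesis
    unfolding nilpotent_ring_def by blast
qed

end
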